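(* There is a constant $C$ (independent of $\mathbf A$, $\mathbf U$, $\mathbf D$ and of the unit roundoff $\epsilon$) such that the following holds. Let $\mathbf A=\mathbf U\mathbf D\mathbf U^{-1}$ be a real, diagonalizable $3\times3$ matrix with real spectrum ($\mathbf U\in\mathbb{R}^{3\times3}$ invertible, $\mathbf D$ real diagonal), and let $\kappa_2=\|\mathbf U\|_2\|\mathbf U^{-1}\|_2$ be the spectral condition number of $\mathbf U$. Then the value $\mathrm{fl}(J_2)$ computed in floating-point arithmetic by Algorithm J2 (given in the context) with input $\mathbf A$ satisfies $$|\mathrm{fl}(J_2)-J_2(\mathbf A)|\le C\,\kappa_2^2\,J_2(\mathbf A)\,\epsilon+\mathcal O(\epsilon^2).$$ In particular, if $\mathbf A$ is symmetric (so that one may take $\kappa_2=1$), the algorithm is accurate, i.e. for $J_2(\mathbf A)\neq0$, $$\frac{|\mathrm{fl}(J_2)-J_2(\mathbf A)|}{|J_2(\mathbf A)|}\le C\epsilon+\mathcal O(\epsilon^2).$$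
   Context: For $\mathbf A\in\mathbb{R}^{3\times3}$ (entries $A_{ij}$, $i,j\in\{0,1,2\}$), $\mathrm{dev}(\mathbf A)=\mathbf A-\tfrac13\mathrm{tr}(\mathbf A)\mathbf I$ and $J_2(\mathbf A)=\tfrac12\mathrm{tr}(\mathrm{dev}(\mathbf A)^2)$. $\|\cdot\|_2$ is the spectral norm. Floating-point model: each elementary operation $\mathrm{op}\in\{+,-,*,/\}$ is computed with $\mathrm{fl}(x\,\mathrm{op}\,y)=(x\,\mathrm{op}\,y)(1+\delta)$, where $|\delta|\le\epsilon$ and $\delta$ may differ from operation to operation; $\epsilon$ is the unit roundoff (no overflow or underflow). The entries of the input matrix are taken as exact. Algorithm J2 (sums evaluated left to right; the factor $\tfrac16$ is applied as one division by 6): 1. $d_0=A_{00}-A_{11}$, $d_1=A_{00}-A_{22}$, $d_2=A_{11}-A_{22}$; 2. $\mathrm{offdiag}=A_{01}A_{10}+A_{02}A_{20}+A_{12}A_{21}$; 3. $\mathrm{diag}=\tfrac16(d_0^2+d_1^2+d_2^2)$; 4. return $\mathrm{diag}+\mathrm{offdiag}$. An algorithm is called accurate if its relative forward error is at most $C\epsilon+\mathcal O(\epsilon^2)$ with a moderate constant $C$. $\mathcal O(\epsilon^2)$ is understood as $\epsilon\to0$ for fixed $\mathbf A$: a quantity bounded by $K\epsilon^2$ for all sufficiently small $\epsilon$, with $K$ independent of $\epsilon$ and of the individual rounding errors (but possibly depending on $\mathbf A$). *)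

theory Defs
  imports "HOL-Analysis.Analysis" "HOL-Library.Monad_Syntax"
begin

text \<open>The index type \<open>3\<close> has the elements 0, 1, 2 (and \<open>3 = 0\<close>), so
  \<open>A $ i $ j\<close> with \<open>i, j \<in> {0, 1, 2}\<close> is the entry in row \<open>i\<close>, column \<open>j\<close>.\<close>

definition dev :: "real^3^3 \<Rightarrow> real^3^3" where
  "dev A = A - (trace A / 3) *\<^sub>R mat 1"

definition J2 :: "real^3^3 \<Rightarrow> real" where
  "J2 A = trace (dev A ** dev A) / 2"

definition spectral_norm :: "real^3^3 \<Rightarrow> real" where
  "spectral_norm A = onorm (\<lambda>x. A *v x)"

definition cond2 :: "real^3^3 \<Rightarrow> real" where
  "cond2 U = spectral_norm U * spectral_norm (matrix_inv U)"

definition diagonalizes :: "real^3^3 \<Rightarrow> real^3^3 \<Rightarrow> real^3^3 \<Rightarrow> bool" where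
  "diagonalizes U D A \<longleftrightarrow>
     invertible U \<and> (\<forall>i j. i \<noteq> j \<longrightarrow> D $ i $ j = 0) \<and> A = U ** D ** matrix_inv U"

text \<open>All values that may result from rounding the exact result \<open>x\<close> of one elementary
  operation, with unit roundoff \<open>\<epsilon>\<close>.\<close>

definition fl :: "real \<Rightarrow> real \<Rightarrow> real set" where
  "fl \<epsilon> x = {x * (1 + \<delta>) | \<delta>. \<bar>\<delta>\<bar> \<le> \<epsilon>}"

text \<open>All values the algorithm may return; the bind is that of the set monad, so the rounding
  errors of the individual operations are chosen independently of each
  other.\<close>

definition fl_J2 :: "real \<Rightarrow> real^3^3 \<Rightarrow> real set" where
  "fl_J2 \<epsilon> A = do {
     d0 \<leftarrow> fl \<epsilon> (A$0$0 - A$1$1);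
     d1 \<leftarrow> fl \<epsilon> (A$0$0 - A$2$2);
     d2 \<leftarrow> fl \<epsilon> (A$1$1 - A$2$2);
     p0 \<leftarrow> fl \<epsilon> (A$0$1 * A$1$0);
     p1 \<leftarrow> fl \<epsilon> (A$0$2 * A$2$0);
     p2 \<leftarrow> fl \<epsilon> (A$1$2 * A$2$1);
     p01 \<leftarrow> fl \<epsilon> (p0 + p1);
     offdiag \<leftarrow> fl \<epsilon> (p01 + p2);
     q0 \<leftarrow> fl \<epsilon> (d0 * d0);
     q1 \<leftarrow> fl \<epsilon> (d1 * d1);
     q2 \<leftarrow> fl \<epsilon> (d2 * d2);
     q01 \<leftarrow> fl \<epsilon> (q0 + q1);
     q012 \<leftarrow> fl \<epsilon> (q01 + q2);
     diag \<leftarrow> fl \<epsilon> (q012 / 6);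
     fl \<epsilon> (diag + offdiag)
   }"

end

theory Submission
  imports Defs
begin

text \<open>
  Every summand of the algorithm is a product of two off-diagonal entries or of two differences
  of diagonal entries of \<open>dev A\<close>, and it
  undergoes a bounded number of roundings, so the error is at most a constant times \<open>\<epsilon>\<close>
  times the squared Frobenius norm of \<open>dev A\<close>. Since \<open>dev A = U ** dev D ** matrix_inv U\<close>,
  that norm is at most a constant times \<open>(cond2 U)\<^sup>2\<close> times the squared Frobenius norm of the
  diagonal matrix \<open>dev D\<close>, which is \<open>2 * J2 D = 2 * J2 A\<close>. For \<open>\<epsilon> \<le> 1\<close> the bound
  holds without a quadratic remainder. The symmetric case follows by the spectral theorem.
\<close>

section \<open>Spectral theorem for self-adjoint maps and symmetric matrices\<close>

text \<open>A maximiser of the Rayleigh quotient on the compact unit sphere of \<open>S\<close> is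
  an eigenvector.\<close>

lemma selfadjoint_eigenvector:
  fixes f :: "'a::euclidean_space \<Rightarrow> 'a"
  assumes "linear f" and sa: "\<And>x y. f x \<bullet> y = x \<bullet> f y"
    and S: "subspace S" and inv: "f ` S \<subseteq> S" and "S \<noteq> {0}"
  obtains v c where "v \<in> S" "norm v = 1" "f v = c *\<^sub>R v"
proof -
  interpret linear f by fact
  have ne: "sphere 0 1 \<inter> S \<noteq> {}"
  proof -
    obtain x where "x \<in> S" "x \<noteq> 0"
      using \<open>S \<noteq> {0}\<close> subspace_0[OF S] by blast
    then have "(1 / norm x) *\<^sub>R x \<in> sphere 0 1 \<inter> S"
      using S by (auto simp: subspace_scale)
    then show ?thesis by blast
  qed
  have "compact (sphere 0 1 \<inter> S)"
    by (intro compact_Int_closed closed_subspace S) simp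
  moreover have "continuous_on (sphere 0 1 \<inter> S) (\<lambda>x. x \<bullet> f x)"
    by (intro continuous_intros linear_continuous_on) (simp add: linear_conv_bounded_linear[symmetric] \<open>linear f\<close>)
  ultimately obtain v where v: "v \<in> sphere 0 1 \<inter> S"
    and max: "\<And>x. x \<in> sphere 0 1 \<inter> S \<Longrightarrow> x \<bullet> f x \<le> v \<bullet> f v"
    using continuous_attains_sup[OF _ ne] by blast
  define c where "c = v \<bullet> f v"
  have vS: "v \<in> S" and nv: "norm v = 1" and vv: "v \<bullet> v = 1"
    using v by (auto simp: norm_eq_1)
  \<comment> \<open>Homogeneity carries the maximum over to all of \<open>S\<close>, so that it
    applies to perturbations of \<open>v\<close> that are not normalised.\<close>
  have rayleigh: "x \<bullet> f x \<le> c * (x \<bullet> x)" if "x \<in> S" for x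
  proof (cases "x = 0")
    case False
    let ?u = "(1 / norm x) *\<^sub>R x"
    have "?u \<in> sphere 0 1 \<inter> S"
      using that False S by (auto simp: subspace_scale)
    from max[OF this] have "(x \<bullet> f x) / (norm x)\<^sup>2 \<le> c"
      by (simp add: c_def scale power2_eq_square)
    then show ?thesis
      using False by (simp add: divide_le_eq power2_norm_eq_inner)
  qed simp
  \<comment> \<open>The residual of the eigenvector equation; it is the component of
    \<open>f v\<close> orthogonal to \<open>v\<close>.\<close>
  define w where "w = f v - c *\<^sub>R v"
  have wS: "w \<in> S"
    unfolding w_def using inv vS by (intro subspace_diff[OF S] subspace_scale[OF S]) auto
  have wv: "v \<bullet> w = 0"
    by (simp add: w_def inner_diff_right vv c_def)
  have fvw: "f v \<bullet> w = w \<bullet> w"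
    using wv by (simp add: w_def inner_diff_left inner_diff_right inner_commute)
  define e where "e = w \<bullet> f w - c * (w \<bullet> w)"
  \<comment> \<open>Expand \<open>rayleigh\<close> at \<open>v + t *\<^sub>R w\<close>: the terms
    without \<open>t\<close> cancel, and \<open>e\<close> collects the coefficient of the square of
    \<open>t\<close>.\<close>
  have key: "2 * t * (w \<bullet> w) + t\<^sup>2 * e \<le> 0" for t
  proof -
    have "v + t *\<^sub>R w \<in> S"
      by (intro subspace_add subspace_scale S vS wS)
    from rayleigh[OF this] show ?thesis
      using wv fvw sa[of w v] sa[of v w]
      by (simp add: add scale vv c_def[symmetric] e_def
          inner_commute algebra_simps power2_eq_square)
  qed
  \<comment> \<open>A perturbation of the maximiser in the direction \<open>w\<close> gains to first order unless \<open>w = 0\<close>.\<close>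
  have "w \<bullet> w = 0"
  proof (rule ccontr)
    assume "w \<bullet> w \<noteq> 0"
    then have pos: "w \<bullet> w > 0" by (simp add: less_le)
    \<comment> \<open>Small enough that the quadratic term cannot outweigh the linear one, with a
      denominator that is positive even for \<open>e = 0\<close>.\<close>
    define t where "t = (w \<bullet> w) / (\<bar>e\<bar> + 1)"
    have t: "t > 0" using pos by (simp add: t_def)
    have "t * \<bar>e\<bar> < w \<bullet> w"
      using pos by (simp add: t_def divide_less_eq algebra_simps)
    moreover have "- (t * e) \<le> t * \<bar>e\<bar>"
      using t mult_left_mono[of "- e" "\<bar>e\<bar>" t] by simp
    ultimately have "2 * (w \<bullet> w) + t * e > 0" using pos by linarith
    then have "t * (2 * (w \<bullet> w) + t * e) > 0" using t by simp
    with key[of t] show False by (simp add: algebra_simps power2_eq_square)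
  qed
  then have "f v = c *\<^sub>R v" by (simp add: w_def)
  then show ?thesis using that vS nv by blast
qed

text \<open>Induction on the dimension: split off one unit eigenvector and continue in its
  orthogonal complement within \<open>S\<close>.\<close>

lemma selfadjoint_orthonormal_eigenbasis:
  fixes f :: "'a::euclidean_space \<Rightarrow> 'a"
  assumes "linear f" and sa: "\<And>x y. f x \<bullet> y = x \<bullet> f y"
    and "subspace S" and "f ` S \<subseteq> S"
  shows "\<exists>B. finite B \<and> B \<subseteq> S \<and> card B = dim S \<and> pairwise orthogonal B \<and>
    (\<forall>b\<in>B. norm b = 1 \<and> (\<exists>c. f b = c *\<^sub>R b))"
  using assms(3,4)
proof (induction "dim S" arbitrary: S)
  case 0
  then show ?case by (intro exI[of _ "{}"]) auto
next
  case (Suc n)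
  interpret linear f by fact
  have "S \<noteq> {0}" using Suc.hyps(2) by auto
  then obtain v c where v: "v \<in> S" "norm v = 1" "f v = c *\<^sub>R v"
    using selfadjoint_eigenvector[OF assms(1,2) Suc.prems] by blast
  \<comment> \<open>Written with \<open>span {v}\<close> to fit
    \<open>dim_subspace_orthogonal_to_vectors\<close>; \<open>T_eq\<close> is the form used
    afterwards.\<close>
  define T where "T = {y \<in> S. \<forall>x\<in>span {v}. orthogonal x y}"
  have T_eq: "T = {y \<in> S. v \<bullet> y = 0}"
    unfolding T_def orthogonal_def span_singleton by (auto dest: spec[of _ 1])
  have "dim T + dim (span {v}) = dim S"
    unfolding T_def using v(1) Suc.prems(1)
    by (intro dim_subspace_orthogonal_to_vectors) (auto simp: span_minimal)
  moreover have "dim (span {v}) = 1"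
    using v(2) by (subst dim_span, subst dim_eq_card_independent) auto
  ultimately have dT: "n = dim T" using Suc.hyps(2) by simp
  have "subspace T"
    unfolding T_eq using Suc.prems(1)
    by (auto simp: subspace_def inner_add_right)
  \<comment> \<open>Self-adjointness moves \<open>f\<close> onto \<open>v\<close>, where it acts as
    multiplication by \<open>c\<close>.\<close>
  moreover have "f ` T \<subseteq> T"
    unfolding T_eq using Suc.prems(2) v(3) by (auto simp: sa[symmetric])
  ultimately obtain B where B: "finite B" "B \<subseteq> T" "card B = dim T" "pairwise orthogonal B"
    "\<forall>b\<in>B. norm b = 1 \<and> (\<exists>c. f b = c *\<^sub>R b)"
    using Suc.hyps(1)[OF dT] by blast
  have "v \<notin> B"
    using B(2) v(2) unfolding T_eq by auto
  moreover have "pairwise orthogonal (insert v B)"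
    using B(2,4) unfolding T_eq by (auto simp: pairwise_insert orthogonal_def inner_commute)
  moreover have "insert v B \<subseteq> S"
    using B(2) v(1) unfolding T_eq by auto
  ultimately show ?case
    using B(1,3,5) v(2,3) dT Suc.hyps(2)
    by (intro exI[of _ "insert v B"]) auto
qed

text \<open>The columns of \<open>U\<close> are the orthonormal eigenvectors, indexed through a
  bijection \<open>g\<close>, and \<open>D\<close> carries their eigenvalues.\<close>

lemma symmetric_matrix_orthogonal_eigenmatrix:
  fixes A :: "real^'n^'n"
  assumes "transpose A = A"
  obtains U D where "orthogonal_matrix U" "\<And>i j. i \<noteq> j \<Longrightarrow> D $ i $ j = 0" "A ** U = U ** D"
proof -
  have sa: "(A *v x) \<bullet> y = x \<bullet> (A *v y)" for x y
    using assms dot_lmul_matrix[of x A y] by (simp flip: transpose_matrix_vector)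
  obtain B where B: "finite B" "card B = CARD('n)" "pairwise orthogonal B"
    and eig: "\<And>b. b \<in> B \<Longrightarrow> norm b = 1 \<and> (\<exists>c. A *v b = c *\<^sub>R b)"
    using selfadjoint_orthonormal_eigenbasis[OF matrix_vector_mul_linear sa subspace_UNIV] by auto
  obtain g where g: "bij_betw g (UNIV :: 'n set) B"
    using finite_same_card_bij[of "UNIV :: 'n set" B] B by auto
  have gB: "g i \<in> B" for i using g by (auto simp: bij_betw_def)
  obtain c where c: "\<And>i. A *v g i = c i *\<^sub>R g i"
    using eig[OF gB] by metis
  define U :: "real^'n^'n" where "U = (\<chi> i j. g j $ i)"
  define D :: "real^'n^'n" where "D = (\<chi> i j. if i = j then c i else 0)"
  have col: "column j U = g j" for j
    by (simp add: U_def column_def vec_eq_iff)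
  have "orthogonal (g i) (g j)" if "i \<noteq> j" for i j
    using B(3) gB g that by (auto simp: pairwise_def bij_betw_def inj_eq)
  then have "orthogonal_matrix U"
    using eig[OF gB] by (auto simp: orthogonal_matrix_orthonormal_columns col)
  moreover have "A ** U = U ** D"
  proof -
    have "(A ** U) $ i $ j = (U ** D) $ i $ j" for i j
    proof -
      have "(A ** U) $ i $ j = (A *v g j) $ i"
        by (simp add: matrix_matrix_mult_def matrix_vector_mult_def U_def)
      also have "\<dots> = (U ** D) $ i $ j"
        by (simp add: c matrix_matrix_mult_def U_def D_def if_distrib cong: if_cong)
      finally show ?thesis .
    qed
    then show ?thesis by (simp add: vec_eq_iff)
  qed
  ultimately show ?thesis using that[of U D] by (simp add: D_def)
qed

section \<open>Inverses, orthogonal matrices and diagonalization with condition number 1\<close>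

lemma invertible_matrix_inv:
  fixes U :: "'a::semiring_1^'n^'m"
  assumes "invertible U"
  shows matrix_inv_right: "U ** matrix_inv U = mat 1"
    and matrix_inv_left: "matrix_inv U ** U = mat 1"
  using someI_ex[OF assms[unfolded invertible_def]] by (auto simp: matrix_inv_def)

lemma matrix_inv_orthogonal_matrix:
  fixes U :: "real^'n^'n"
  assumes "orthogonal_matrix U"
  shows "matrix_inv U = transpose U"
proof -
  have "invertible U" and T: "transpose U ** U = mat 1"
    using assms by (auto simp: orthogonal_matrix_def invertible_def)
  have "matrix_inv U = transpose U ** U ** matrix_inv U"
    by (simp add: T)
  also have "\<dots> = transpose U ** (U ** matrix_inv U)"
    by (simp add: matrix_mul_assoc)
  also have "\<dots> = transpose U"
    by (simp add: matrix_inv_right[OF \<open>invertible U\<close>])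
  finally show ?thesis .
qed

lemma spectral_norm_orthogonal_matrix:
  assumes "orthogonal_matrix U"
  shows "spectral_norm U = 1"
proof -
  have "norm (U *v x) = norm x" for x
    using assms orthogonal_transformation_matrix[of "(*v) U"]
    by (simp add: orthogonal_transformation_norm)
  \<comment> \<open>\<open>onorm\<close> depends on a map only through the norms of its values, so
    an isometry has that of the identity.\<close>
  then have "spectral_norm U = onorm (\<lambda>x::real^3. x)"
    by (simp add: spectral_norm_def onorm_def)
  then show ?thesis
    using onorm_id[where 'a="real^3"] by simp
qed

lemma symmetric_diagonalizes:
  assumes "transpose A = A"
  obtains U D where "diagonalizes U D A" "cond2 U = 1"
proof -
  obtain U D where U: "orthogonal_matrix U" and D: "\<And>i j. i \<noteq> j \<Longrightarrow> D $ i $ j = 0"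
    and AU: "A ** U = U ** D"
    using symmetric_matrix_orthogonal_eigenmatrix[OF assms] by blast
  have "A = A ** (U ** transpose U)"
    using U by (simp add: orthogonal_matrix_def)
  also have "\<dots> = U ** D ** matrix_inv U"
    by (simp add: matrix_mul_assoc AU matrix_inv_orthogonal_matrix[OF U])
  finally have "A = U ** D ** matrix_inv U" .
  moreover have "invertible U"
    using U by (auto simp: orthogonal_matrix_def invertible_def)
  ultimately have "diagonalizes U D A"
    using D by (simp add: diagonalizes_def)
  moreover have "cond2 U = 1"
    using U by (simp add: cond2_def matrix_inv_orthogonal_matrix spectral_norm_orthogonal_matrix)
  ultimately show ?thesis by (rule that)
qed

section \<open>Spectral norm against Frobenius norm\<close>

text \<open>Cauchy-Schwarz in each row; \<open>norm\<close> of a matrix is the Frobenius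
  norm.\<close>

lemma norm_matrix_vector_mult_le:
  fixes M :: "real^'n^'m"
  shows "norm (M *v x) \<le> norm M * norm x"
proof -
  have "norm (M *v x) = L2_set (\<lambda>i. \<bar>M $ i \<bullet> x\<bar>) UNIV"
    by (simp add: norm_vec_def matrix_vector_mul_component)
  also have "\<dots> \<le> L2_set (\<lambda>i. norm (M $ i) * norm x) UNIV"
    by (intro L2_set_mono) (auto simp: Cauchy_Schwarz_ineq2)
  also have "\<dots> = norm M * norm x"
    by (simp add: norm_vec_def L2_set_left_distrib)
  finally show ?thesis .
qed

lemma spectral_norm_le_norm: "spectral_norm M \<le> norm M"
  unfolding spectral_norm_def by (intro onorm_le norm_matrix_vector_mult_le)

lemma spectral_norm_nonneg: "0 \<le> spectral_norm M"
  unfolding spectral_norm_def by (intro onorm_pos_le matrix_vector_mul_bounded_linear)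

lemma spectral_norm_mult: "spectral_norm (M ** N) \<le> spectral_norm M * spectral_norm N"
  using onorm_compose[OF matrix_vector_mul_bounded_linear matrix_vector_mul_bounded_linear, of M N]
  by (simp add: spectral_norm_def o_def matrix_vector_mul_assoc)

lemma power2_norm_matrix:
  fixes M :: "real^'n^'m"
  shows "(norm M)\<^sup>2 = (\<Sum>i\<in>UNIV. \<Sum>j\<in>UNIV. (M $ i $ j)\<^sup>2)"
  unfolding power2_norm_eq_inner by (simp add: inner_vec_def power2_eq_square)

text \<open>The factor 3 counts the columns: each is the image of a unit vector, so its length is at
  most the spectral norm.\<close>

lemma power2_norm_le_spectral_norm: "(norm M)\<^sup>2 \<le> 3 * (spectral_norm M)\<^sup>2"
proof -
  have "(norm M)\<^sup>2 = (\<Sum>j\<in>UNIV. \<Sum>i\<in>UNIV. (M $ i $ j)\<^sup>2)"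
    unfolding power2_norm_matrix by (rule sum.swap)
  also have "\<dots> = (\<Sum>j\<in>UNIV. (norm (M *v axis j 1))\<^sup>2)"
    unfolding power2_norm_eq_inner
    by (simp add: inner_vec_def power2_eq_square matrix_vector_mult_basis column_def)
  also have "\<dots> \<le> (\<Sum>j\<in>(UNIV :: 3 set). (spectral_norm M)\<^sup>2)"
  proof (intro sum_mono power_mono)
    show "norm (M *v axis j 1) \<le> spectral_norm M" for j
      using onorm[OF matrix_vector_mul_bounded_linear, of M "axis j 1"]
      by (simp add: spectral_norm_def)
  qed simp
  finally show ?thesis by simp
qed

section \<open>\<open>J2\<close> and \<open>dev\<close> in terms of entries\<close>

text \<open>Reconciles \<open>sum_3\<close>, which runs over 1, 2, 3, with the indices 0, 1,
  2.\<close>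

lemma three_eq_zero: "(3::3) = 0"
  by simp

text \<open>This is the expression that the algorithm evaluates, so its whole error comes from
  rounding.\<close>

lemma J2_entries:
  "J2 A = ((A$0$0 - A$1$1)\<^sup>2 + (A$0$0 - A$2$2)\<^sup>2 + (A$1$1 - A$2$2)\<^sup>2) / 6 +
    (A$0$1 * A$1$0 + A$0$2 * A$2$0 + A$1$2 * A$2$1)"
  by (simp add: J2_def dev_def trace_def matrix_matrix_mult_def mat_def sum_3 three_eq_zero field_simps
      power2_eq_square)

text \<open>The diagonal parts of both sides agree, since the squared deviations of three numbers
  from their mean sum to a third of their squared pairwise differences; the off-diagonal products
  are bounded by \<open>amgm\<close>.\<close>

lemma entries_le_norm_dev:
  "((A$0$0 - A$1$1)\<^sup>2 + (A$0$0 - A$2$2)\<^sup>2 + (A$1$1 - A$2$2)\<^sup>2) / 6 +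
    (\<bar>A$0$1 * A$1$0\<bar> + \<bar>A$0$2 * A$2$0\<bar> + \<bar>A$1$2 * A$2$1\<bar>) \<le> (norm (dev A))\<^sup>2 / 2"
proof -
  have amgm: "\<bar>x * y\<bar> \<le> (x\<^sup>2 + y\<^sup>2) / 2" for x y :: real
    using sum_squares_bound[of "\<bar>x\<bar>" "\<bar>y\<bar>"] by (simp add: abs_mult)
  have "(norm (dev A))\<^sup>2 / 2 =
    ((A$0$0 - A$1$1)\<^sup>2 + (A$0$0 - A$2$2)\<^sup>2 + (A$1$1 - A$2$2)\<^sup>2) / 6 +
    (((A$0$1)\<^sup>2 + (A$1$0)\<^sup>2) / 2 + ((A$0$2)\<^sup>2 + (A$2$0)\<^sup>2) / 2 + ((A$1$2)\<^sup>2 + (A$2$1)\<^sup>2) / 2)"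
    unfolding power2_norm_matrix
    by (simp add: dev_def trace_def mat_def sum_3 three_eq_zero field_simps power2_eq_square)
  then show ?thesis
    using amgm[of "A$0$1" "A$1$0"] amgm[of "A$0$2" "A$2$0"] amgm[of "A$1$2" "A$2$1"] by linarith
qed

section \<open>Similarity, and the role of the condition number\<close>

lemma trace_similar:
  fixes U X :: "real^'n^'n"
  assumes "invertible U"
  shows "trace (U ** X ** matrix_inv U) = trace X"
  using assms trace_mul_sym[of "U ** X" "matrix_inv U"]
  by (simp add: matrix_mul_assoc matrix_inv_left)

lemma matrix_diff_ldistrib:
  fixes X :: "'a::ring_1^'n^'m"
  shows "X ** (Y - Z) = X ** Y - X ** Z"
  by (simp add: matrix_matrix_mult_def vec_eq_iff right_diff_distrib sum_subtractf)

lemma matrix_diff_rdistrib: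
  fixes X :: "'a::ring_1^'n^'m"
  shows "(X - Y) ** Z = X ** Z - Y ** Z"
  by (simp add: matrix_matrix_mult_def vec_eq_iff left_diff_distrib sum_subtractf)

text \<open>Conjugation preserves the trace and fixes multiples of the identity.\<close>

lemma dev_similar:
  assumes "invertible U"
  shows "dev (U ** X ** matrix_inv U) = U ** dev X ** matrix_inv U"
proof -
  have "U ** (c *\<^sub>R mat 1) ** matrix_inv U = c *\<^sub>R mat 1" for c
    by (simp add: matrix_scalar_ac scalar_matrix_assoc[symmetric] matrix_inv_right[OF assms])
  then show ?thesis
    by (simp add: dev_def trace_similar[OF assms] matrix_diff_ldistrib matrix_diff_rdistrib)
qed

lemma J2_similar:
  assumes "invertible U"
  shows "J2 (U ** X ** matrix_inv U) = J2 X"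
proof -
  have "(U ** dev X ** matrix_inv U) ** (U ** dev X ** matrix_inv U) =
      U ** dev X ** (matrix_inv U ** U) ** dev X ** matrix_inv U"
    by (simp add: matrix_mul_assoc)
  also have "\<dots> = U ** (dev X ** dev X) ** matrix_inv U"
    using assms by (simp add: matrix_inv_left matrix_mul_assoc)
  finally show ?thesis
    using assms by (simp add: J2_def dev_similar trace_similar)
qed

text \<open>The trace of the square of a diagonal matrix is its squared Frobenius norm; for general
  matrices the two may differ.\<close>

lemma J2_diagonal:
  assumes "\<And>i j. i \<noteq> j \<Longrightarrow> D $ i $ j = 0"
  shows "J2 D = (norm (dev D))\<^sup>2 / 2"
  using assms unfolding J2_def power2_norm_matrix
  by (simp add: dev_def trace_def matrix_matrix_mult_def mat_def sum_3 power2_eq_square)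

lemma J2_diagonalizable_nonneg:
  assumes "diagonalizes U D A"
  shows "0 \<le> J2 A"
proof -
  have "J2 A = (norm (dev D))\<^sup>2 / 2"
    using assms J2_similar[of U D] J2_diagonal[of D] by (auto simp: diagonalizes_def)
  also have "\<dots> \<ge> 0" by (intro divide_nonneg_pos zero_le_power2) simp
  finally show ?thesis .
qed

text \<open>The 6 is 3 from passing from the Frobenius to the spectral norm of \<open>dev A\<close>,
  times 2 from \<open>J2_diagonal\<close>.\<close>

lemma norm_dev_le_cond2:
  assumes "diagonalizes U D A"
  shows "(norm (dev A))\<^sup>2 \<le> 6 * (cond2 U)\<^sup>2 * J2 A"
proof -
  have U: "invertible U" and D: "\<And>i j. i \<noteq> j \<Longrightarrow> D $ i $ j = 0"
    and A: "A = U ** D ** matrix_inv U"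
    using assms by (auto simp: diagonalizes_def)
  have "spectral_norm (dev A) \<le> spectral_norm (U ** dev D) * spectral_norm (matrix_inv U)"
    unfolding A dev_similar[OF U] by (rule spectral_norm_mult)
  also have "\<dots> \<le> spectral_norm U * norm (dev D) * spectral_norm (matrix_inv U)"
    by (intro mult_right_mono order.trans[OF spectral_norm_mult] mult_left_mono
        spectral_norm_le_norm spectral_norm_nonneg)
  finally have "(spectral_norm (dev A))\<^sup>2 \<le> (cond2 U * norm (dev D))\<^sup>2"
    by (intro power_mono spectral_norm_nonneg) (simp add: cond2_def mult_ac)
  moreover have "(norm (dev D))\<^sup>2 = 2 * J2 A"
    using J2_diagonal[OF D] J2_similar[OF U, of D] A by simp
  ultimately show ?thesis
    using power2_norm_le_spectral_norm[of "dev A"] by (simp add: power_mult_distrib)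
qed

section \<open>Rounding error analysis\<close>

text \<open>A further factor is at most 2 in absolute value, so the constant \<open>m\<close> grows
  to at most \<open>2 * m + 1\<close>; hence a bound linear in \<epsilon> without higher-order
  terms.\<close>

lemma prod_list_rounding_factors:
  fixes ts :: "real list"
  assumes "\<forall>t\<in>set ts. \<bar>t - 1\<bar> \<le> \<epsilon>" "0 \<le> \<epsilon>" "\<epsilon> \<le> 1"
  shows "\<bar>prod_list ts - 1\<bar> \<le> (2 ^ length ts - 1) * \<epsilon>"
  using assms(1)
proof (induction ts)
  case (Cons t ts)
  let ?P = "prod_list ts"
  have "t * ?P - 1 = t * (?P - 1) + (t - 1)"
    by (simp add: algebra_simps)
  also have "\<bar>\<dots>\<bar> \<le> \<bar>t\<bar> * \<bar>?P - 1\<bar> + \<bar>t - 1\<bar>"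
    by (metis abs_mult abs_triangle_ineq)
  also have "\<dots> \<le> 2 * ((2 ^ length ts - 1) * \<epsilon>) + \<epsilon>"
    using Cons assms(3) by (intro add_mono mult_mono) auto
  finally show ?case by (simp add: algebra_simps)
qed simp

lemma perturbation_le:
  fixes x t :: real
  assumes "\<bar>t - 1\<bar> \<le> e"
  shows "\<bar>x * t - x\<bar> \<le> \<bar>x\<bar> * e"
proof -
  have "x * t - x = x * (t - 1)" by (simp add: algebra_simps)
  then show ?thesis using assms by (simp add: abs_mult mult_left_mono)
qed

lemma fl_J2_error:
  assumes "r \<in> fl_J2 \<epsilon> A" "0 \<le> \<epsilon>" "\<epsilon> \<le> 1"
  shows "\<bar>r - J2 A\<bar> \<le> 127 * \<epsilon> * ((norm (dev A))\<^sup>2 / 2)"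
proof -
  define D0 D1 D2 where "D0 = A$0$0 - A$1$1" and "D1 = A$0$0 - A$2$2" and "D2 = A$1$1 - A$2$2"
  define P0 P1 P2 where "P0 = A$0$1 * A$1$0" and "P1 = A$0$2 * A$2$0" and "P2 = A$1$2 * A$2$1"
  obtain d0 d1 d2 p0 p1 p2 p01 offdiag q0 q1 q2 q01 q012 diag where steps:
    "d0 \<in> fl \<epsilon> D0" "d1 \<in> fl \<epsilon> D1" "d2 \<in> fl \<epsilon> D2"
    "p0 \<in> fl \<epsilon> P0" "p1 \<in> fl \<epsilon> P1" "p2 \<in> fl \<epsilon> P2"
    "p01 \<in> fl \<epsilon> (p0 + p1)" "offdiag \<in> fl \<epsilon> (p01 + p2)"
    "q0 \<in> fl \<epsilon> (d0 * d0)" "q1 \<in> fl \<epsilon> (d1 * d1)" "q2 \<in> fl \<epsilon> (d2 * d2)"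
    "q01 \<in> fl \<epsilon> (q0 + q1)" "q012 \<in> fl \<epsilon> (q01 + q2)" "diag \<in> fl \<epsilon> (q012 / 6)"
    "r \<in> fl \<epsilon> (diag + offdiag)"
    using assms(1) unfolding fl_J2_def bind_UNION
      D0_def[symmetric] D1_def[symmetric] D2_def[symmetric]
      P0_def[symmetric] P1_def[symmetric] P2_def[symmetric]
    by - (elim UN_E, rule that, assumption+)
  have flE: "\<exists>t. \<bar>t - 1\<bar> \<le> \<epsilon> \<and> y = x * t" if "y \<in> fl \<epsilon> x" for x y
    using that by (force simp: fl_def intro: exI[of _ "1 + _"])
  obtain a0 a1 a2 where a: "d0 = D0 * a0" "d1 = D1 * a1"
      "d2 = D2 * a2" "\<bar>a0 - 1\<bar> \<le> \<epsilon>" "\<bar>a1 - 1\<bar> \<le> \<epsilon>" "\<bar>a2 - 1\<bar> \<le> \<epsilon>"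
    using steps(1-3)[THEN flE] by blast
  obtain b0 b1 b2 b01 b where b: "p0 = P0 * b0" "p1 = P1 * b1"
      "p2 = P2 * b2" "p01 = (p0 + p1) * b01" "offdiag = (p01 + p2) * b"
      "\<bar>b0 - 1\<bar> \<le> \<epsilon>" "\<bar>b1 - 1\<bar> \<le> \<epsilon>" "\<bar>b2 - 1\<bar> \<le> \<epsilon>" "\<bar>b01 - 1\<bar> \<le> \<epsilon>" "\<bar>b - 1\<bar> \<le> \<epsilon>"
    using steps(4-8)[THEN flE] by blast
  obtain c0 c1 c2 c01 c where c: "q0 = d0 * d0 * c0" "q1 = d1 * d1 * c1"
      "q2 = d2 * d2 * c2" "q01 = (q0 + q1) * c01" "q012 = (q01 + q2) * c"
      "\<bar>c0 - 1\<bar> \<le> \<epsilon>" "\<bar>c1 - 1\<bar> \<le> \<epsilon>" "\<bar>c2 - 1\<bar> \<le> \<epsilon>" "\<bar>c01 - 1\<bar> \<le> \<epsilon>" "\<bar>c - 1\<bar> \<le> \<epsilon>"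
    using steps(9-13)[THEN flE] by blast
  obtain d h where d: "diag = q012 / 6 * d" "r = (diag + offdiag) * h"
      "\<bar>d - 1\<bar> \<le> \<epsilon>" "\<bar>h - 1\<bar> \<le> \<epsilon>"
    using steps(14,15)[THEN flE] by blast
  \<comment> \<open>127 is \<open>2 ^ 7 - 1\<close>: no summand collects more than seven rounding
    factors.\<close>
  define E where "E = 127 * \<epsilon>"
  define Q0 Q1 Q2 where "Q0 = D0\<^sup>2 / 6" and "Q1 = D1\<^sup>2 / 6" and "Q2 = D2\<^sup>2 / 6"
  \<comment> \<open>The rounding factors met by each summand on its way to \<open>r\<close>. Those
    of the differences occur twice because of the squaring; \<open>c01\<close> and
    \<open>b01\<close> are absent from \<open>s2\<close> and \<open>t2\<close> because the third
    summand joins after the first addition.\<close>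
  define s0 where "s0 = prod_list [a0, a0, c0, c01, c, d, h]"
  define s1 where "s1 = prod_list [a1, a1, c1, c01, c, d, h]"
  define s2 where "s2 = prod_list [a2, a2, c2, c, d, h]"
  define t0 where "t0 = prod_list [b0, b01, b, h]"
  define t1 where "t1 = prod_list [b1, b01, b, h]"
  define t2 where "t2 = prod_list [b2, b, h]"
  have bound: "\<bar>prod_list ts - 1\<bar> \<le> E" if "\<forall>t\<in>set ts. \<bar>t - 1\<bar> \<le> \<epsilon>" "length ts \<le> 7" for ts
  proof -
    have "(2::real) ^ length ts \<le> 2 ^ 7"
      using that(2) by (intro power_increasing) auto
    then have "(2 ^ length ts - 1) * \<epsilon> \<le> E"
      unfolding E_def using assms(2) by (intro mult_right_mono) auto
    with prod_list_rounding_factors[OF that(1) assms(2,3)] show ?thesis by linarith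
  qed
  have factors: "\<bar>s0 - 1\<bar> \<le> E" "\<bar>s1 - 1\<bar> \<le> E" "\<bar>s2 - 1\<bar> \<le> E"
    "\<bar>t0 - 1\<bar> \<le> E" "\<bar>t1 - 1\<bar> \<le> E" "\<bar>t2 - 1\<bar> \<le> E"
    unfolding s0_def s1_def s2_def t0_def t1_def t2_def
    by (intro bound; simp add: a b c d)+
  have "r = Q0 * s0 + Q1 * s1 + Q2 * s2 + (P0 * t0 + P1 * t1 + P2 * t2)"
    by (simp add: d(1,2) c(1-5) b(1-5) a(1-3) Q0_def Q1_def Q2_def
        s0_def s1_def s2_def t0_def t1_def t2_def power2_eq_square algebra_simps add_divide_distrib)
  moreover have "J2 A = Q0 + Q1 + Q2 + (P0 + P1 + P2)"
    by (simp add: J2_entries Q0_def Q1_def Q2_def D0_def D1_def D2_def P0_def P1_def P2_def add_divide_distrib)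
  ultimately have "r - J2 A = (Q0 * s0 - Q0) + (Q1 * s1 - Q1) + (Q2 * s2 - Q2) +
      ((P0 * t0 - P0) + (P1 * t1 - P1) + (P2 * t2 - P2))"
    by simp
  \<comment> \<open>The \<open>P\<close> terms may cancel in \<open>J2 A\<close>, so the error is
    measured against the absolute values of the summands.\<close>
  then have "\<bar>r - J2 A\<bar> \<le>
      \<bar>Q0\<bar> * E + \<bar>Q1\<bar> * E + \<bar>Q2\<bar> * E + (\<bar>P0\<bar> * E + \<bar>P1\<bar> * E + \<bar>P2\<bar> * E)"
    by (simp only:)
      (intro order.trans[OF abs_triangle_ineq] add_mono factors[THEN perturbation_le])
  also have "\<dots> = E * (Q0 + Q1 + Q2 + (\<bar>P0\<bar> + \<bar>P1\<bar> + \<bar>P2\<bar>))"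
    by (simp add: Q0_def Q1_def Q2_def algebra_simps)
  also have "\<dots> \<le> E * ((norm (dev A))\<^sup>2 / 2)"
    using entries_le_norm_dev[of A] assms(2)
    by (intro mult_left_mono)
      (simp_all add: E_def Q0_def Q1_def Q2_def D0_def D1_def D2_def P0_def P1_def P2_def add_divide_distrib)
  finally show ?thesis by (simp add: E_def)
qed

text \<open>The constant is \<open>127 * 6 / 2\<close>.\<close>

lemma fl_J2_error_cond2:
  assumes "r \<in> fl_J2 \<epsilon> A" "0 \<le> \<epsilon>" "\<epsilon> \<le> 1" "diagonalizes U D A"
  shows "\<bar>r - J2 A\<bar> \<le> 381 * (cond2 U)\<^sup>2 * J2 A * \<epsilon>"
proof -
  have "127 * \<epsilon> * ((norm (dev A))\<^sup>2 / 2) \<le> 127 * \<epsilon> * (6 * (cond2 U)\<^sup>2 * J2 A / 2)"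
    using norm_dev_le_cond2[OF assms(4)] assms(2)
    by (intro mult_left_mono divide_right_mono) auto
  also have "\<dots> = 381 * (cond2 U)\<^sup>2 * J2 A * \<epsilon>" by simp
  finally show ?thesis
    using fl_J2_error[OF assms(1-3)] by linarith
qed

theorem corollary5:
  shows "\<exists>C::real. C > 0 \<and>
    (\<forall>A::real^3^3. \<exists>K::real. \<forall>\<^sub>F \<epsilon> in at_right 0. \<forall>U D. \<forall>r \<in> fl_J2 \<epsilon> A.
       diagonalizes U D A \<longrightarrow>
       \<bar>r - J2 A\<bar> \<le> C * (cond2 U)\<^sup>2 * J2 A * \<epsilon> + K * \<epsilon>\<^sup>2) \<and>
    (\<forall>A::real^3^3. transpose A = A \<longrightarrow>
       (\<exists>U D. diagonalizes U D A \<and> cond2 U = 1) \<and>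
       (J2 A \<noteq> 0 \<longrightarrow>
         (\<exists>K::real. \<forall>\<^sub>F \<epsilon> in at_right 0. \<forall>r \<in> fl_J2 \<epsilon> A.
            \<bar>r - J2 A\<bar> / \<bar>J2 A\<bar> \<le> C * \<epsilon> + K * \<epsilon>\<^sup>2)))"
proof (rule exI[of _ 381], intro conjI allI impI)
  \<comment> \<open>The limit serves only to ensure \<open>\<epsilon> \<le> 1\<close>; the remainder
    constant \<open>K\<close> is 0 in both claims.\<close>
  have small: "\<forall>\<^sub>F \<epsilon> in at_right 0. (0::real) \<le> \<epsilon> \<and> \<epsilon> \<le> 1"
    by (rule eventually_at_rightI[of 0 1]) auto
  show "\<exists>K::real. \<forall>\<^sub>F \<epsilon> in at_right 0. \<forall>U D. \<forall>r \<in> fl_J2 \<epsilon> A.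
      diagonalizes U D A \<longrightarrow> \<bar>r - J2 A\<bar> \<le> 381 * (cond2 U)\<^sup>2 * J2 A * \<epsilon> + K * \<epsilon>\<^sup>2" for A
    using small
    by (intro exI[of _ 0]) (auto elim!: eventually_mono intro: fl_J2_error_cond2)
  fix A :: "real^3^3"
  assume "transpose A = A"
  then obtain U D where U: "diagonalizes U D A" "cond2 U = 1"
    by (rule symmetric_diagonalizes)
  then show "\<exists>U D. diagonalizes U D A \<and> cond2 U = 1" by blast
  assume "J2 A \<noteq> 0"
  then have pos: "0 < J2 A" using J2_diagonalizable_nonneg[OF U(1)] by simp
  have "\<bar>r - J2 A\<bar> / \<bar>J2 A\<bar> \<le> 381 * \<epsilon> + 0 * \<epsilon>\<^sup>2"
    if "0 \<le> \<epsilon> \<and> \<epsilon> \<le> 1" "r \<in> fl_J2 \<epsilon> A" for \<epsilon> r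
    using fl_J2_error_cond2[OF that(2) _ _ U(1)] that(1) pos U(2)
    by (simp add: divide_le_eq algebra_simps)
  then show "\<exists>K::real. \<forall>\<^sub>F \<epsilon> in at_right 0. \<forall>r \<in> fl_J2 \<epsilon> A.
      \<bar>r - J2 A\<bar> / \<bar>J2 A\<bar> \<le> 381 * \<epsilon> + K * \<epsilon>\<^sup>2"
    using small by (intro exI[of _ 0]) (auto elim!: eventually_mono)
qed simp

end
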